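(* Let $l, m \ge 1$ be integers and let $\mathfrak{B} : S^{m-1} \to S^{m-1}$ be a polynomial stochastic operator (PSO) associated with a stochastic hypermatrix $\mathcal{P} = (P_{i_1\cdots i_l,k})_{i_1,\dots,i_l,k\in I_m}$. Then the following statements are equivalent: (i) $\mathfrak{B}$ is orthogonal preserving; (ii) $\mathfrak{B}$ is surjective; (iii) there is a permutation $\pi$ of $I_m$ such that $\mathfrak{B}$ satisfies all of the following conditions $(1),(2),\dots,(l)$: condition $(1)$ is $\mathfrak{B}^{-1}(\{\mathbf{e}_i\}) = \{\mathbf{e}_{\pi(i)}\}$ for any $i \in I_m$; and, for each $k \in \{2,\dots,l\}$, condition $(k)$ is $$\mathfrak{B}^{-1}\bigl(\mathrm{int}\,\Gamma_{\mathbf{e}_{i_1}\cdots \mathbf{e}_{i_k}}\bigr) = \mathrm{int}\,\Gamma_{\mathbf{e}_{\pi(i_1)}\cdots \mathbf{e}_{\pi(i_k)}} \quad \text{for any } i_1,\dots,i_k \in I_m .$$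
   Context: $I_m = \{1,\dots,m\}$; $\{\mathbf{e}_i\}_{i\in I_m}$ is the standard basis of $\mathbb{R}^m$; the simplex is $S^{m-1} = \{\mathbf{x}\in\mathbb{R}^m : x_i \ge 0 \ \forall i \in I_m,\ \sum_{i=1}^m x_i = 1\}$, and its elements are called stochastic vectors. Stochastic hypermatrix: a real array $\mathcal{P} = (P_{i_1\cdots i_l,k})_{i_1,\dots,i_l,k\in I_m}$ such that for all $i_1,\dots,i_l\in I_m$ the vector $P_{i_1\cdots i_l,\bullet} = (P_{i_1\cdots i_l,1},\dots,P_{i_1\cdots i_l,m})$ belongs to $S^{m-1}$. Standing assumption: $P_{i_1\cdots i_l,\bullet}$ is invariant under every permutation of the indices $i_1,\dots,i_l$. The associated polynomial stochastic operator (PSO) $\mathfrak{B}:S^{m-1}\to S^{m-1}$ is $$\mathfrak{B}(\mathbf{x}) = \sum_{i_1=1}^m\cdots\sum_{i_l=1}^m x_{i_1}\cdots x_{i_l}\, P_{i_1\cdots i_l,\bullet}.$$ For $\mathbf{x}\in S^{m-1}$, $\mathrm{supp}(\mathbf{x}) = \{i\in I_m : x_i\neq 0\}$. Vectors $\mathbf{x},\mathbf{y}\in S^{m-1}$ are orthogonal, $\mathbf{x}\perp\mathbf{y}$, if $\mathrm{supp}(\mathbf{x})\cap\mathrm{supp}(\mathbf{y})=\emptyset$. A PSO $\mathfrak{B}$ is orthogonal preserving if for all $\mathbf{x},\mathbf{y}\in S^{m-1}$, $\mathbf{x}\perp\mathbf{y}$ implies $\mathfrak{B}(\mathbf{x})\perp\mathfrak{B}(\mathbf{y})$.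 For $A\subset I_m$, $\Gamma_A = \mathrm{conv}\{\mathbf{e}_i\}_{i\in A}$ and $\mathrm{int}\,\Gamma_A = \{\mathbf{x}\in\Gamma_A : x_i>0\ \forall i\in A\}$. We write $\Gamma_{\mathbf{e}_{i_1}\cdots\mathbf{e}_{i_k}} = \mathrm{conv}\{\mathbf{e}_{i_1},\dots,\mathbf{e}_{i_k}\}$, i.e. $\Gamma_A$ with $A=\{i_1,\dots,i_k\}$. $\mathfrak{B}^{-1}(\cdot)$ denotes the preimage in $S^{m-1}$. *)

theory Defs
  imports "HOL-Analysis.Analysis"
begin

text \<open>The index set \<open>I_m\<close> is rendered as a finite type \<open>'m\<close> with \<open>m = CARD('m)\<close>;
  the standard basis vector \<open>e_i\<close> is \<^term>\<open>axis i 1\<close>.\<close>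

definition std_simplex :: "(real ^ 'm) set" where
  "std_simplex = {x. (\<forall>i. x $ i \<ge> 0) \<and> (\<Sum>i\<in>UNIV. x $ i) = 1}"

text \<open>A hypermatrix is a map from multi-indices \<open>(i_1, \<dots>, i_l)\<close>, represented as lists, to vectors:
  the entry \<open>P_{i_1...i_l,k}\<close> is \<^term>\<open>P [i1, i2] $ k\<close> (here for \<open>l = 2\<close>).
  Only the values on lists of length \<open>l\<close> matter.\<close>

definition stochastic_hypermatrix :: "nat \<Rightarrow> ('m list \<Rightarrow> real ^ 'm) \<Rightarrow> bool" where
  "stochastic_hypermatrix l P \<longleftrightarrow> (\<forall>is. length is = l \<longrightarrow> P is \<in> std_simplex)"

definition permutation_invariant :: "nat \<Rightarrow> ('m list \<Rightarrow> real ^ 'm) \<Rightarrow> bool" where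
  "permutation_invariant l P \<longleftrightarrow>
     (\<forall>is js. length is = l \<and> length js = l \<and> mset is = mset js \<longrightarrow> P is = P js)"

definition pso :: "nat \<Rightarrow> ('m list \<Rightarrow> real ^ 'm) \<Rightarrow> real ^ 'm \<Rightarrow> real ^ 'm" where
  "pso l P x = (\<Sum>is | length is = l. (\<Prod>i\<leftarrow>is. x $ i) *\<^sub>R P is)"

definition supp :: "real ^ 'm \<Rightarrow> 'm set" where
  "supp x = {i. x $ i \<noteq> 0}"

text \<open>Orthogonality means disjoint supports; it is not the library's inner-product relation
  \<^const>\<open>orthogonal\<close> by definition (though the two agree on the simplex).\<close>

definition supp_orthogonal :: "real ^ 'm \<Rightarrow> real ^ 'm \<Rightarrow> bool" where
  "supp_orthogonal x y \<longleftrightarrow> supp x \<inter> supp y = {}"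

definition orthogonal_preserving :: "(real ^ 'm \<Rightarrow> real ^ 'm) \<Rightarrow> bool" where
  "orthogonal_preserving B \<longleftrightarrow>
     (\<forall>x\<in>std_simplex. \<forall>y\<in>std_simplex. supp_orthogonal x y \<longrightarrow> supp_orthogonal (B x) (B y))"

definition simplex_preimage :: "(real ^ 'm \<Rightarrow> real ^ 'm) \<Rightarrow> (real ^ 'm) set \<Rightarrow> (real ^ 'm) set" where
  "simplex_preimage B T = {x \<in> std_simplex. B x \<in> T}"

definition face :: "'m set \<Rightarrow> (real ^ 'm) set" where
  "face A = convex hull ((\<lambda>i. axis i 1) ` A)"

definition int_face :: "'m set \<Rightarrow> (real ^ 'm) set" where
  "int_face A = {x \<in> face A. \<forall>i\<in>A. x $ i > 0}"

end

theory Submission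
  imports Defs
begin

text \<open>All three conditions are equivalent to the existence of a permutation \<open>\<sigma>\<close> of the index set with
  \<open>supp (\<BB> x) = \<sigma> ` supp x\<close> on the simplex. The support of \<open>\<BB> x\<close> is the union of the supports of
  the \<open>P is\<close> with \<open>is\<close> ranging over the words in \<open>supp x\<close>; so it depends only on \<open>supp x\<close>,
  monotonically, and everything except surjectivity is combinatorics of supports. Surjectivity of
  such a map comes from Brouwer's theorem: for a target \<open>y\<close>, a fixed point of the normalisation of
  \<open>x\<^sub>i + max 0 (y\<^bsub>\<sigma> i\<^esub> - \<BB>(x)\<^bsub>\<sigma> i\<^esub>)\<close> is a preimage of \<open>y\<close>.\<close>

section \<open>Supports and faces of the simplex\<close>

lemma std_simplex_nonneg: "x \<in> std_simplex \<Longrightarrow> 0 \<le> x $ i"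
  by (simp add: std_simplex_def)

lemma std_simplex_sum: "x \<in> std_simplex \<Longrightarrow> (\<Sum>i\<in>UNIV. x $ i) = 1"
  by (simp add: std_simplex_def)

lemma supp_nonempty: "x \<in> std_simplex \<Longrightarrow> supp x \<noteq> {}"
  by (rule notI) (simp add: std_simplex_def supp_def)

lemma sum_supp:
  assumes "x \<in> std_simplex" "supp x \<subseteq> A"
  shows "(\<Sum>i\<in>A. x $ i) = 1"
proof -
  have "(\<Sum>i\<in>A. x $ i) = (\<Sum>i\<in>UNIV. x $ i)"
    by (rule sum.mono_neutral_left) (use assms in \<open>auto simp: supp_def\<close>)
  then show ?thesis
    using assms std_simplex_sum by metis
qed

lemma axis_in_std_simplex: "axis i 1 \<in> std_simplex"
  by (auto simp: std_simplex_def axis_def)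

lemma supp_axis: "supp (axis i 1) = {i}"
  by (auto simp: supp_def axis_def)

lemma supp_singleton_iff:
  assumes "x \<in> std_simplex"
  shows "supp x = {i} \<longleftrightarrow> x = axis i 1"
proof
  assume s: "supp x = {i}"
  have "x $ i = 1"
    using sum_supp[OF assms, of "{i}"] s by simp
  moreover have "x $ j = 0" if "j \<noteq> i" for j
    using s that by (auto simp: supp_def)
  ultimately show "x = axis i 1"
    by (auto simp: vec_eq_iff axis_def)
qed (simp add: supp_axis)

lemma ex_std_simplex_supp:
  fixes A :: "'m::finite set"
  assumes "A \<noteq> {}"
  shows "\<exists>x\<in>std_simplex. supp x = A"
proof
  let ?x = "(\<chi> i. if i \<in> A then 1 / real (card A) else 0) :: real ^ 'm"
  show "supp ?x = A"
    using assms by (auto simp: supp_def card_eq_0_iff)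
  have "(\<Sum>i\<in>UNIV. ?x $ i) = (\<Sum>i\<in>A. 1 / real (card A))"
    by (simp add: sum.If_cases)
  also have "\<dots> = 1"
    using assms by (simp add: card_eq_0_iff)
  finally show "?x \<in> std_simplex"
    by (simp add: std_simplex_def)
qed

text \<open>The right-hand side is convex and contains the vertices of \<open>A\<close>. Conversely,
  a point supported in \<open>A\<close> is the convex combination of these vertices with its own
  coordinates as weights.\<close>

lemma face_eq: "face A = {x \<in> std_simplex. supp x \<subseteq> A}"
proof
  let ?S = "{x \<in> std_simplex. supp x \<subseteq> A}"
  have "convex ?S"
    unfolding convex_def
  proof (intro ballI allI impI)
    fix x y :: "real ^ 'a" and u v :: real
    assume *: "x \<in> ?S" "y \<in> ?S" "0 \<le> u" "0 \<le> v" "u + v = 1"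
    then have "(\<Sum>i\<in>UNIV. u * x $ i + v * y $ i) = 1"
      by (simp add: sum.distrib std_simplex_sum flip: sum_distrib_left)
    then show "u *\<^sub>R x + v *\<^sub>R y \<in> ?S"
      using * by (auto simp: std_simplex_def supp_def subset_iff) (metis add_0 mult_zero_right)
  qed
  then show "face A \<subseteq> ?S"
    unfolding face_def by (intro hull_minimal) (auto simp: axis_in_std_simplex supp_axis)
next
  show "{x \<in> std_simplex. supp x \<subseteq> A} \<subseteq> face A"
  proof clarify
    fix x :: "real ^ 'a"
    assume x: "x \<in> std_simplex" "supp x \<subseteq> A"
    have "(\<Sum>i\<in>A. x $ i *\<^sub>R axis i 1) \<in> face A"
      unfolding face_def
      by (rule convex_sum)
        (use x in \<open>auto simp: sum_supp std_simplex_nonneg convex_convex_hull intro: hull_inc\<close>)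
    moreover have "x = (\<Sum>i\<in>A. x $ i *\<^sub>R axis i 1)"
      using x by (auto simp: vec_eq_iff axis_def supp_def if_distrib[of "(*) _"] cong: if_cong)
    ultimately show "x \<in> face A"
      by simp
  qed
qed

text \<open>This turns every condition on preimages of open faces into a condition on
  supports.\<close>

lemma int_face_eq: "int_face A = {x \<in> std_simplex. supp x = A}"
  by (auto simp: int_face_def face_eq supp_def std_simplex_nonneg less_le)

lemma std_simplex_eq_face: "std_simplex = face UNIV"
  by (simp add: face_eq)

lemma convex_std_simplex: "convex std_simplex"
  by (simp add: std_simplex_eq_face face_def)

lemma compact_std_simplex: "compact (std_simplex :: (real ^ 'm::finite) set)"
  by (simp add: std_simplex_eq_face face_def finite_imp_compact_convex_hull)

section \<open>Polynomial stochastic operators\<close>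

lemma finite_words: "finite {is :: 'm::finite list. length is = l}"
  using finite_lists_length_eq[of "UNIV :: 'm set" l] by simp

text \<open>Expansion of a power of a sum over words, by splitting off the first letter. On the
  simplex it shows that the weights of the \<open>P is\<close> in \<open>pso l P x\<close> add up to
  1.\<close>

lemma sum_words_prod:
  fixes x :: "'m::finite \<Rightarrow> real"
  shows "(\<Sum>is | length is = l. \<Prod>i\<leftarrow>is. x i) = (\<Sum>i\<in>UNIV. x i) ^ l"
proof (induction l)
  case 0
  then show ?case by simp
next
  case (Suc l)
  have eq: "{is :: 'm list. length is = Suc l} = (\<lambda>(i, is). i # is) ` (UNIV \<times> {is. length is = l})"
    by (auto simp: length_Suc_conv image_iff)
  have inj: "inj_on (\<lambda>(i, is). i # is) (UNIV \<times> {is :: 'm list. length is = l})"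
    by (auto simp: inj_on_def)
  have "(\<Sum>is | length is = Suc l. \<Prod>i\<leftarrow>is. x i)
      = (\<Sum>(i, is)\<in>UNIV \<times> {is. length is = l}. x i * (\<Prod>i\<leftarrow>is. x i))"
    unfolding eq by (subst sum.reindex[OF inj]) (auto intro!: sum.cong)
  also have "\<dots> = (\<Sum>i\<in>UNIV. x i) * (\<Sum>is | length is = l. \<Prod>i\<leftarrow>is. x i)"
    by (simp add: sum_product sum.cartesian_product)
  finally show ?case
    using Suc by simp
qed

lemma pso_component: "pso l P x $ k = (\<Sum>is | length is = l. (\<Prod>i\<leftarrow>is. x $ i) * P is $ k)"
  by (simp add: pso_def)

lemma prod_std_simplex_nonneg: "x \<in> std_simplex \<Longrightarrow> 0 \<le> (\<Prod>i\<leftarrow>is. x $ i)"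
  by (induction "is") (auto simp: std_simplex_nonneg)

lemma prod_eq_0_iff_supp: "(\<Prod>i\<leftarrow>is. x $ i) = 0 \<longleftrightarrow> \<not> set is \<subseteq> supp x"
  by (induction "is") (auto simp: supp_def)

lemma pso_in_std_simplex:
  assumes P: "stochastic_hypermatrix l P" and x: "x \<in> std_simplex"
  shows "pso l P x \<in> std_simplex"
proof -
  have Pis: "P is \<in> std_simplex" if "length is = l" for "is"
    using P that by (simp add: stochastic_hypermatrix_def)
  have "(\<Sum>k\<in>UNIV. pso l P x $ k)
      = (\<Sum>is | length is = l. (\<Prod>i\<leftarrow>is. x $ i) * (\<Sum>k\<in>UNIV. P is $ k))"
    unfolding pso_component by (subst sum.swap) (simp add: sum_distrib_left)
  also have "\<dots> = (\<Sum>is | length is = l. \<Prod>i\<leftarrow>is. x $ i)"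
    by (intro sum.cong) (auto simp: Pis std_simplex_sum)
  also have "\<dots> = 1"
    using x by (simp add: sum_words_prod std_simplex_sum)
  finally have "(\<Sum>k\<in>UNIV. pso l P x $ k) = 1" .
  moreover have "0 \<le> pso l P x $ k" for k
    unfolding pso_component
    by (auto intro!: sum_nonneg mult_nonneg_nonneg simp: Pis std_simplex_nonneg
        prod_std_simplex_nonneg[OF x])
  ultimately show ?thesis
    by (simp add: std_simplex_def)
qed

text \<open>All terms are nonnegative, so nothing cancels: a coordinate vanishes iff each of its
  terms does, and a weight is nonzero iff its word stays in \<open>supp x\<close>.\<close>

lemma supp_pso:
  assumes P: "stochastic_hypermatrix l P" and x: "x \<in> std_simplex"
  shows "supp (pso l P x) = (\<Union>is\<in>{is. length is = l \<and> set is \<subseteq> supp x}. supp (P is))"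
proof -
  have "pso l P x $ k = 0 \<longleftrightarrow> (\<forall>is. length is = l \<longrightarrow> (\<Prod>i\<leftarrow>is. x $ i) * P is $ k = 0)" for k
    unfolding pso_component
    by (subst sum_nonneg_eq_0_iff)
      (use P in \<open>auto simp: finite_words stochastic_hypermatrix_def std_simplex_nonneg
        prod_std_simplex_nonneg[OF x]\<close>)
  then show ?thesis
    by (auto simp: supp_def[of "pso l P x"] supp_def[of "P _"] prod_eq_0_iff_supp)
qed

lemma supp_pso_mono:
  assumes "stochastic_hypermatrix l P" "x \<in> std_simplex" "y \<in> std_simplex" "supp x \<subseteq> supp y"
  shows "supp (pso l P x) \<subseteq> supp (pso l P y)"
  using assms by (auto simp: supp_pso)

lemma continuous_on_prod_list:
  fixes f :: "'i \<Rightarrow> 'a::topological_space \<Rightarrow> real"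
  assumes "\<And>i. i \<in> set is \<Longrightarrow> continuous_on S (f i)"
  shows "continuous_on S (\<lambda>x. \<Prod>i\<leftarrow>is. f i x)"
  using assms by (induction "is") (auto intro!: continuous_intros)

lemma continuous_on_pso: "continuous_on S (pso l P)"
  unfolding pso_def by (intro continuous_intros continuous_on_prod_list)

section \<open>The permutation of supports\<close>

text \<open>\<open>\<sigma>\<close> pushes supports forward, while the permutation
  \<open>\<pi>\<close> of the preimage conditions pulls faces back; the two will be inverse to each
  other.\<close>

definition permutes_supports :: "('m \<Rightarrow> 'm) \<Rightarrow> (real ^ 'm \<Rightarrow> real ^ 'm) \<Rightarrow> bool" where
  "permutes_supports \<sigma> B \<longleftrightarrow> bij \<sigma> \<and> (\<forall>x\<in>std_simplex. supp (B x) = \<sigma> ` supp x)"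

text \<open>Stated for continuous maps in general, since the argument rests on invariance of faces
  up to relabelling: it confines the mass of \<open>f x\<close> to the \<sigma>-image of
  \<open>supp x\<close>, so \<open>f x\<close> cannot fall short of \<open>y\<close> at all of those
  coordinates.\<close>

lemma support_preserving_imp_surj:
  fixes f :: "real ^ 'm::finite \<Rightarrow> real ^ 'm"
  assumes cont: "continuous_on std_simplex f"
    and maps: "\<And>x. x \<in> std_simplex \<Longrightarrow> f x \<in> std_simplex"
    and bij: "bij \<sigma>"
    and supp: "\<And>x. x \<in> std_simplex \<Longrightarrow> supp (f x) \<subseteq> \<sigma> ` supp x"
    and y: "y \<in> std_simplex"
  shows "\<exists>x\<in>std_simplex. f x = y"
proof -
  \<comment> \<open>\<open>d x i\<close> is the shortfall of \<open>f x\<close> below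
    \<open>y\<close> at coordinate \<open>\<sigma> i\<close>; \<open>g\<close> adds it to coordinate
    \<open>i\<close> and rescales to total mass 1.\<close>
  define d where "d x i = max 0 (y $ \<sigma> i - f x $ \<sigma> i)" for x i
  define D where "D x = (\<Sum>i\<in>UNIV. d x i)" for x
  define g where "g x = (\<chi> i. (x $ i + d x i) / (1 + D x))" for x
  have d0: "0 \<le> d x i" for x i
    by (simp add: d_def)
  have D0: "0 \<le> D x" for x
    unfolding D_def by (intro sum_nonneg d0)
  have cont_d: "continuous_on std_simplex (\<lambda>x. d x i)" for i
    unfolding d_def by (intro continuous_intros cont)
  have "continuous_on std_simplex g"
    unfolding g_def
  proof (intro continuous_on_vec_lambda continuous_on_divide continuous_on_add cont_d)
    show "continuous_on std_simplex D"
      unfolding D_def by (intro continuous_on_sum cont_d)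
    show "\<forall>x\<in>std_simplex. 1 + D x \<noteq> 0"
      using D0 by (smt (verit))
  qed (auto intro!: continuous_intros)
  moreover have "g x \<in> std_simplex" if x: "x \<in> std_simplex" for x
  proof -
    have "(\<Sum>i\<in>UNIV. g x $ i) = (1 + D x) / (1 + D x)"
      unfolding g_def by (simp add: sum.distrib std_simplex_sum[OF x] D_def flip: sum_divide_distrib)
    also have "\<dots> = 1"
      using D0[of x] by simp
    finally show ?thesis
      using d0 D0 x by (simp add: std_simplex_def g_def)
  qed
  ultimately obtain x where x: "x \<in> std_simplex" and fixed: "g x = x"
    using brouwer[of std_simplex g] compact_std_simplex convex_std_simplex y by blast
  \<comment> \<open>At a fixed point the shortfall vector is proportional to \<open>x\<close>, with
    factor the total shortfall.\<close>
  have d_eq: "d x i = D x * x $ i" for i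
  proof -
    have "(x $ i + d x i) / (1 + D x) = x $ i"
      using fixed by (simp add: g_def vec_eq_iff)
    then show ?thesis
      using D0[of x] by (simp add: field_simps)
  qed
  have sum_\<sigma>: "(\<Sum>i\<in>UNIV. z $ \<sigma> i) = 1" if "z \<in> std_simplex" for z
    using sum.reindex_bij_betw[OF bij, of "\<lambda>i. z $ i"] std_simplex_sum[OF that] by simp
  have "D x = 0"
  proof (rule ccontr)
    assume "D x \<noteq> 0"
    \<comment> \<open>Then \<open>supp x\<close> is exactly where \<open>f x\<close> falls short of \<open>y\<close>, yet it carries all the mass of \<open>f x\<close>.\<close>
    have less: "f x $ \<sigma> i < y $ \<sigma> i" if "i \<in> supp x" for i
    proof -
      have "d x i \<noteq> 0"
        using \<open>D x \<noteq> 0\<close> d_eq[of i] that by (simp add: supp_def)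
      then show ?thesis
        by (simp add: d_def max_def split: if_splits)
    qed
    have zero: "f x $ \<sigma> i = 0" if "i \<notin> supp x" for i
      using supp[OF x] that bij by (auto simp: supp_def dest: bij_is_inj injD)
    have "(\<Sum>i\<in>UNIV. f x $ \<sigma> i) < (\<Sum>i\<in>UNIV. y $ \<sigma> i)"
    proof (rule sum_strict_mono_ex1)
      show "\<forall>i\<in>UNIV. f x $ \<sigma> i \<le> y $ \<sigma> i"
        using less zero std_simplex_nonneg[OF y] by (metis less_imp_le)
      show "\<exists>i\<in>UNIV. f x $ \<sigma> i < y $ \<sigma> i"
        using less supp_nonempty[OF x] by blast
    qed simp
    then show False
      using sum_\<sigma> maps[OF x] y by simp
  qed
  \<comment> \<open>Without any shortfall \<open>f x\<close> dominates \<open>y\<close>; equal total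
    mass then forces equality.\<close>
  then have le: "y $ \<sigma> i \<le> f x $ \<sigma> i" for i
    using d_eq[of i] by (simp add: d_def max_def split: if_splits)
  have "(\<Sum>i\<in>UNIV. f x $ \<sigma> i - y $ \<sigma> i) = 0"
    using sum_\<sigma> maps[OF x] y by (simp add: sum_subtractf)
  then have "f x $ \<sigma> i = y $ \<sigma> i" for i
    by (subst (asm) sum_nonneg_eq_0_iff) (auto simp: le)
  then have "f x = y"
    using bij by (metis bij_pointE vec_eq_iff)
  with x show ?thesis by blast
qed

lemma permutes_supports_imp_surj:
  assumes "stochastic_hypermatrix l P" "permutes_supports \<sigma> (pso l P)"
  shows "pso l P ` std_simplex = std_simplex"
proof
  show "pso l P ` std_simplex \<subseteq> std_simplex"
    using assms(1) by (auto intro: pso_in_std_simplex)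
  show "std_simplex \<subseteq> pso l P ` std_simplex"
    using support_preserving_imp_surj[of "pso l P" \<sigma>] assms
    by (fastforce simp: continuous_on_pso pso_in_std_simplex permutes_supports_def)
qed

lemma permutes_supports_imp_orthogonal_preserving:
  assumes "permutes_supports \<sigma> B"
  shows "orthogonal_preserving B"
  using assms
  by (auto simp: permutes_supports_def orthogonal_preserving_def supp_orthogonal_def bij_is_inj
      simp flip: image_Int)

text \<open>The images of the vertices have nonempty, pairwise disjoint supports, so picking one
  index from each gives an injection, hence a bijection of the finite index set.\<close>

lemma orthogonal_preserving_imp_permutes_supports:
  fixes P :: "'m::finite list \<Rightarrow> real ^ 'm"
  assumes P: "stochastic_hypermatrix l P" and orth: "orthogonal_preserving (pso l P)"
  shows "\<exists>\<sigma>. permutes_supports \<sigma> (pso l P)"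
proof -
  have disj: "supp (pso l P x) \<inter> supp (pso l P y) = {}"
    if "x \<in> std_simplex" "y \<in> std_simplex" "supp x \<inter> supp y = {}" for x y
    using orth that by (auto simp: orthogonal_preserving_def supp_orthogonal_def)
  have "\<forall>i. \<exists>k. k \<in> supp (pso l P (axis i 1))"
    using supp_nonempty[OF pso_in_std_simplex[OF P axis_in_std_simplex]] by blast
  then obtain \<sigma> where \<sigma>: "\<And>i. \<sigma> i \<in> supp (pso l P (axis i 1))"
    by metis
  have "inj \<sigma>"
  proof (rule injI, rule ccontr)
    fix i j assume "\<sigma> i = \<sigma> j" "i \<noteq> j"
    then show False
      using disj[of "axis i 1" "axis j 1"] \<sigma>[of i] \<sigma>[of j]
      by (auto simp: supp_axis axis_in_std_simplex)
  qed
  then have bij: "bij \<sigma>"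
    by (simp add: bij_def finite_UNIV_inj_surj)
  moreover have "supp (pso l P x) = \<sigma> ` supp x" if x: "x \<in> std_simplex" for x
  proof
    show "\<sigma> ` supp x \<subseteq> supp (pso l P x)"
      using supp_pso_mono[OF P axis_in_std_simplex x] \<sigma> by (force simp: supp_axis)
    show "supp (pso l P x) \<subseteq> \<sigma> ` supp x"
    proof
      fix k assume k: "k \<in> supp (pso l P x)"
      obtain j where j: "k = \<sigma> j"
        using bij by (metis bij_pointE)
      \<comment> \<open>Otherwise the vertex of \<open>j\<close> would be orthogonal to
        \<open>x\<close>, although \<open>\<sigma> j\<close> lies in the supports of both
        images.\<close>
      have "j \<in> supp x"
        using disj[OF axis_in_std_simplex x, of j] \<sigma>[of j] k j by (auto simp: supp_axis)
      with j show "k \<in> \<sigma> ` supp x" by blast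
    qed
  qed
  ultimately show ?thesis
    by (auto simp: permutes_supports_def)
qed

text \<open>If \<open>x\<close> is sent to a vertex, then by monotonicity so is every vertex in
  \<open>supp x\<close>. This yields the permutation on vertices; induction on the size of the
  support extends it to all faces.\<close>

lemma surj_imp_permutes_supports:
  fixes P :: "'m::finite list \<Rightarrow> real ^ 'm"
  assumes P: "stochastic_hypermatrix l P" and surj: "pso l P ` std_simplex = std_simplex"
  shows "\<exists>\<sigma>. permutes_supports \<sigma> (pso l P)"
proof -
  have "\<exists>i. supp (pso l P (axis i 1)) = {k}" for k
  proof -
    obtain x where x: "x \<in> std_simplex" "pso l P x = axis k 1"
      using surj axis_in_std_simplex by (metis imageE)
    then obtain i where i: "i \<in> supp x"
      using supp_nonempty by blast
    then have "supp (pso l P (axis i 1)) \<subseteq> {k}"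
      using supp_pso_mono[OF P axis_in_std_simplex x(1), of i] x by (simp add: supp_axis)
    then show ?thesis
      using supp_nonempty[OF pso_in_std_simplex[OF P axis_in_std_simplex]] by blast
  qed
  then obtain \<tau> where \<tau>: "\<And>k. supp (pso l P (axis (\<tau> k) 1)) = {k}"
    by metis
  have "inj \<tau>"
    by (rule injI) (metis \<tau> singleton_inject)
  then have bij_\<tau>: "bij \<tau>"
    by (simp add: bij_def finite_UNIV_inj_surj)
  define \<sigma> where "\<sigma> = inv \<tau>"
  have bij: "bij \<sigma>"
    using bij_\<tau> by (simp add: \<sigma>_def bij_imp_bij_inv)
  have \<tau>\<sigma>: "\<tau> (\<sigma> i) = i" and \<sigma>\<tau>: "\<sigma> (\<tau> i) = i" for i
    using bij_\<tau> by (simp_all add: \<sigma>_def bij_is_surj surj_f_inv_f bij_is_inj)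
  have ge: "\<sigma> ` supp x \<subseteq> supp (pso l P x)" if "x \<in> std_simplex" for x
  proof
    fix k assume "k \<in> \<sigma> ` supp x"
    then have "\<tau> k \<in> supp x"
      by (auto simp: \<tau>\<sigma>)
    then show "k \<in> supp (pso l P x)"
      using supp_pso_mono[OF P axis_in_std_simplex that, of "\<tau> k"] \<tau>[of k] by (simp add: supp_axis)
  qed
  have "supp (pso l P x) = \<sigma> ` supp x" if "x \<in> std_simplex" for x
    using that
  proof (induction "card (supp x)" arbitrary: x rule: less_induct)
    case less
    \<comment> \<open>A target whose support is the \<sigma>-image of \<open>supp x\<close>. Its
      preimage \<open>z\<close> must have the same support as \<open>x\<close>, and images of points
      with equal supports have equal supports.\<close>
    define y :: "real ^ 'm" where "y = (\<chi> k. x $ \<tau> k)"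
    have "y \<in> std_simplex"
      using less.prems sum.reindex_bij_betw[OF bij_\<tau>, of "\<lambda>i. x $ i"]
      by (simp add: std_simplex_def y_def)
    then obtain z where z: "z \<in> std_simplex" "pso l P z = y"
      using surj by (metis imageE)
    have "supp y = \<sigma> ` supp x"
      by (force simp: supp_def y_def \<tau>\<sigma> \<sigma>\<tau> image_iff)
    with z have eq: "supp (pso l P z) = \<sigma> ` supp x"
      by simp
    with ge[OF z(1)] have sub: "supp z \<subseteq> supp x"
      using bij by (simp add: inj_image_subset_iff bij_is_inj)
    have "supp z = supp x"
    proof (rule ccontr)
      assume "supp z \<noteq> supp x"
      with sub have "card (supp z) < card (supp x)"
        by (simp add: psubset_card_mono psubset_eq)
      \<comment> \<open>A smaller support would, by the induction hypothesis, give an image support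
        too small for \<open>y\<close>.\<close>
      then have "supp (pso l P z) = \<sigma> ` supp z"
        using less.hyps z(1) by blast
      with eq \<open>supp z \<noteq> supp x\<close> show False
        using bij by (simp add: inj_image_eq_iff bij_is_inj)
    qed
    with eq show ?case
      using supp_pso[OF P] less.prems z(1) by simp
  qed
  with bij show ?thesis
    by (auto simp: permutes_supports_def)
qed

section \<open>Preimages of open faces\<close>

lemma simplex_preimage_int_face:
  assumes "stochastic_hypermatrix l P"
  shows "simplex_preimage (pso l P) (int_face A) = {x \<in> std_simplex. supp (pso l P x) = A}"
  using assms by (auto simp: simplex_preimage_def int_face_eq pso_in_std_simplex)

lemma int_face_singleton: "int_face {i} = {axis i 1}"
  by (auto simp: int_face_eq supp_axis axis_in_std_simplex simp flip: supp_singleton_iff)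

text \<open>Since \<open>\<sigma>\<close> is bijective, its image map on sets is inverted by that of
  \<open>inv \<sigma>\<close>. As \<open>A\<close> is arbitrary, the vertex condition and those for
  all \<open>k\<close> follow together.\<close>

lemma permutes_supports_imp_preimages:
  fixes P :: "'m::finite list \<Rightarrow> real ^ 'm"
  assumes P: "stochastic_hypermatrix l P" and \<sigma>: "permutes_supports \<sigma> (pso l P)"
  shows "simplex_preimage (pso l P) (int_face A) = int_face (inv \<sigma> ` A)"
proof -
  have "\<sigma> ` S = A \<longleftrightarrow> S = inv \<sigma> ` A" for S
    using \<sigma> unfolding permutes_supports_def
    by (metis bij_is_inj bij_is_surj image_f_inv_f image_inv_f_f)
  then show ?thesis
    using \<sigma> unfolding simplex_preimage_int_face[OF P] permutes_supports_def
    unfolding int_face_eq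
    by (intro Collect_cong) metis
qed

text \<open>The operator is built from words of length \<open>l\<close>, whose letters span faces
  with at most \<open>l\<close> vertices. The conditions locate the image of an interior point of
  such a face, and this bounds the support of each \<open>P is\<close>; the vertices give the
  reverse inclusion.\<close>

lemma preimages_imp_permutes_supports:
  fixes P :: "'m::finite list \<Rightarrow> real ^ 'm"
  assumes l: "l \<ge> 1" and P: "stochastic_hypermatrix l P" and \<pi>: "bij \<pi>"
    and vert: "\<And>i. simplex_preimage (pso l P) {axis i 1} = {axis (\<pi> i) 1}"
    and faces: "\<And>is. l \<ge> 2 \<Longrightarrow> length is = l \<Longrightarrow>
      simplex_preimage (pso l P) (int_face (set is)) = int_face (set (map \<pi> is))"
  shows "permutes_supports (inv \<pi>) (pso l P)"
proof -
  let ?\<sigma> = "inv \<pi>"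
  have \<pi>\<sigma>: "\<pi> (?\<sigma> i) = i" for i
    using \<pi> by (simp add: bij_is_surj surj_f_inv_f)
  have axis: "pso l P (axis i 1) = axis (?\<sigma> i) 1" for i
    using vert[of "?\<sigma> i"] by (auto simp: \<pi>\<sigma> simplex_preimage_def)
  have word: "supp (P is) \<subseteq> ?\<sigma> ` set is" if len: "length is = l" for "is"
  proof -
    have "\<exists>z\<in>std_simplex. supp z = set is \<and> supp (pso l P z) = ?\<sigma> ` set is"
    proof (cases "l \<ge> 2")
      case True
      obtain z where z: "z \<in> std_simplex" "supp z = set is"
        using ex_std_simplex_supp[of "set is"] len l by fastforce
      \<comment> \<open>The face condition is read at the relabelled word, so that the open face on
        its right-hand side is the one containing \<open>z\<close>.\<close>
      have "set (map \<pi> (map ?\<sigma> is)) = set is"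
        by (simp add: image_image \<pi>\<sigma>)
      then have "z \<in> simplex_preimage (pso l P) (int_face (set (map ?\<sigma> is)))"
        using faces[OF True, of "map ?\<sigma> is"] len z by (simp add: int_face_eq)
      then show ?thesis
        using z by (auto simp: simplex_preimage_int_face[OF P])
    next
      case False
      \<comment> \<open>For \<open>l = 1\<close> a word is a single letter, and the vertex condition
        takes over.\<close>
      then have "length is = Suc 0"
        using len l by simp
      then obtain i where "is = [i]"
        by (auto simp: length_Suc_conv)
      then show ?thesis
        using axis by (auto simp: supp_axis axis_in_std_simplex intro!: bexI[of _ "axis i 1"])
    qed
    then show ?thesis
      using supp_pso[OF P] len by blast
  qed
  have "supp (pso l P x) = ?\<sigma> ` supp x" if x: "x \<in> std_simplex" for x
  proof
    show "supp (pso l P x) \<subseteq> ?\<sigma> ` supp x"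
      using word by (fastforce simp: supp_pso[OF P x])
    show "?\<sigma> ` supp x \<subseteq> supp (pso l P x)"
      using supp_pso_mono[OF P axis_in_std_simplex x] axis by (force simp: supp_axis)
  qed
  then show ?thesis
    using \<pi> by (simp add: permutes_supports_def bij_imp_bij_inv)
qed

theorem corollary3p4:
  fixes l :: nat and P :: "'m::finite list \<Rightarrow> real ^ 'm"
  assumes "l \<ge> 1"
    and "stochastic_hypermatrix l P"
    and "permutation_invariant l P"
  shows "(orthogonal_preserving (pso l P) \<longleftrightarrow> pso l P ` std_simplex = std_simplex) \<and>
         (pso l P ` std_simplex = std_simplex \<longleftrightarrow>
           (\<exists>\<pi>. \<pi> permutes (UNIV :: 'm set) \<and>
              (\<forall>i. simplex_preimage (pso l P) {axis i 1} = {axis (\<pi> i) 1}) \<and>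
              (\<forall>k\<in>{2..l}. \<forall>is. length is = k \<longrightarrow>
                 simplex_preimage (pso l P) (int_face (set is)) = int_face (set (map \<pi> is)))))"
    (is "(?orth \<longleftrightarrow> ?surj) \<and> (?surj \<longleftrightarrow> (\<exists>\<pi>. ?pre \<pi>))")
proof -
  note P = assms(2)
  \<comment> \<open>The three conditions are each compared with this one.\<close>
  let ?star = "\<exists>\<sigma>. permutes_supports \<sigma> (pso l P)"
  have "?orth \<longleftrightarrow> ?star"
    using orthogonal_preserving_imp_permutes_supports[OF P]
      permutes_supports_imp_orthogonal_preserving by blast
  moreover have "?surj \<longleftrightarrow> ?star"
    using surj_imp_permutes_supports[OF P] permutes_supports_imp_surj[OF P] by blast
  moreover have "(\<exists>\<pi>. ?pre \<pi>) \<longleftrightarrow> ?star"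
  proof
    assume "\<exists>\<pi>. ?pre \<pi>"
    then obtain \<pi> where pre: "?pre \<pi>" by blast
    have "permutes_supports (inv \<pi>) (pso l P)"
    proof (rule preimages_imp_permutes_supports[OF assms(1) P])
      show "bij \<pi>"
        using pre permutes_bij by blast
    next
      fix "is" :: "'m list"
      assume "l \<ge> 2" "length is = l"
      moreover from this have "l \<in> {2..l}"
        by simp
      ultimately show "simplex_preimage (pso l P) (int_face (set is)) = int_face (set (map \<pi> is))"
        using pre by blast
    qed (use pre in blast)
    then show ?star by blast
  next
    assume ?star
    then obtain \<sigma> where \<sigma>: "permutes_supports \<sigma> (pso l P)" by blast
    then have "inv \<sigma> permutes UNIV"
      by (auto simp: permutes_supports_def intro!: bij_imp_permutes bij_imp_bij_inv)
    moreover have "simplex_preimage (pso l P) {axis i 1} = {axis (inv \<sigma> i) 1}" for i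
      using permutes_supports_imp_preimages[OF P \<sigma>, of "{i}"] by (simp add: int_face_singleton)
    ultimately have "?pre (inv \<sigma>)"
      using permutes_supports_imp_preimages[OF P \<sigma>] by simp
    then show "\<exists>\<pi>. ?pre \<pi>" by blast
  qed
  ultimately show ?thesis by blast
qed

end
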